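(* A positive integer $A$ is a solid rectangular number if and only if there exist positive integers $x,y,z,t$ with $x^2+y^2+z^2=t^2$ and a positive integer $D$, where $D$ is required to be even if exactly two of $x,y,z$ are even and the third is odd (and is arbitrary if $x,y,z$ are all even), such that $A$ is the area of the triangle with integer side lengths $$a=\frac{D(y^2+z^2)}{2},\qquad b=\frac{D(x^2+z^2)}{2},\qquad c=\frac{D(x^2+y^2)}{2}.$$
   Context: A solid rectangular number is a positive integer of the form $$A=\frac{x_0\,y_0\,z_0\,t_0\,d^2}{4},$$ where $x_0,y_0,z_0,t_0$ are positive integers with $x_0^2+y_0^2+z_0^2=t_0^2$ and $\gcd(x_0,y_0,z_0)=1$, and $d$ is an even positive integer. (In any solution of $x^2+y^2+z^2=t^2$ in positive integers at least two of $x,y,z$ are even.) "Area" is the usual Euclidean area. *)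

theory Defs
  imports "HOL-Analysis.Analysis"
begin

definition solid_rectangular :: "nat \<Rightarrow> bool" where
  "solid_rectangular A \<longleftrightarrow> A > 0 \<and>
     (\<exists>x y z t d :: nat. x > 0 \<and> y > 0 \<and> z > 0 \<and> t > 0 \<and> d > 0 \<and> even d \<and>
        x^2 + y^2 + z^2 = t^2 \<and> Gcd {x, y, z} = 1 \<and>
        real A = real (x * y * z * t * d^2) / 4)"

definition triangle_area :: "real \<Rightarrow> real \<Rightarrow> real \<Rightarrow> real \<Rightarrow> bool" where
  "triangle_area a b c S \<longleftrightarrow>
     (\<exists>P Q R :: real ^ 2. \<not> collinear {P, Q, R} \<and>
        dist Q R = a \<and> dist P R = b \<and> dist P Q = c \<and>
        measure lebesgue (convex hull {P, Q, R}) = S)"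

text \<open>The list, unlike the set of its entries, counts repeated values of \<open>x, y, z\<close> separately.\<close>

definition exactly_two_even :: "nat \<Rightarrow> nat \<Rightarrow> nat \<Rightarrow> bool" where
  "exactly_two_even x y z \<longleftrightarrow> length (filter even [x, y, z]) = 2"

end

theory Submission
  imports Defs
begin

text \<open>
  Cut the sides of a triangle at the points where the incircle touches them. With tangent lengths
  \<open>p, q, r > 0\<close> the sides are \<open>q + r, p + r, p + q\<close>, every such triple is realised by a nondegenerate
  triangle, and Heron's formula reads \<open>sqrt ((p + q + r) p q r)\<close>. The sides \<open>a, b, c\<close> of the theorem
  have tangent lengths \<open>D x\<^sup>2 / 2, D y\<^sup>2 / 2, D z\<^sup>2 / 2\<close>, whose sum is \<open>D t\<^sup>2 / 2\<close>. Hence the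
  radicand is a square and the area is \<open>x y z t D\<^sup>2 / 4\<close> (\<open>triangle_area_of_quadruple\<close>): the formula
  for solid rectangular numbers, with a quadruple that need not be primitive.

  Two arithmetical points remain. Squares are \<open>0\<close> or \<open>1\<close> modulo \<open>4\<close>, so at most one of
  \<open>x, y, z\<close> is odd (\<open>quadruple_parity\<close>), and exactly one is odd if the quadruple is primitive; a
  primitive quadruple with even \<open>d\<close> thus gives the triangle with \<open>D = d\<close>. Conversely, a common
  factor \<open>g\<close> moves into the multiplier: \<open>(x, y, z, t) = g (x0, y0, z0, t0)\<close> gives
  \<open>x y z t D\<^sup>2 = x0 y0 z0 t0 (g\<^sup>2 D)\<^sup>2\<close>. Here \<open>d = g\<^sup>2 D\<close> is even: clearly
  for even \<open>g\<close>, while for odd \<open>g\<close> the quadruple has the parities of its primitive part, so exactly two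
  of \<open>x, y, z\<close> are even and \<open>D\<close> is even by its parity condition.
\<close>

section \<open>Triangles with given tangent lengths\<close>

text \<open>
  Three collinear points have one between the other two, and then one distance is the sum of the
  other two; tangent lengths measure how far the sides are from this.
\<close>

lemma not_collinear_if_tangent_lengths:
  fixes P Q R :: "'a :: euclidean_space" and p q r :: real
  assumes "p > 0" "q > 0" "r > 0"
    and "dist Q R = q + r" "dist P R = p + r" "dist P Q = p + q"
  shows "\<not> collinear {P, Q, R}"
proof
  assume "collinear {P, Q, R}"
  then have "between (Q, R) P \<or> between (R, P) Q \<or> between (P, Q) R"
    by (simp add: collinear_between_cases)
  with assms show False
    by (auto simp: between dist_commute)
qed

lemma ex_triangle_with_tangent_lengths:
  fixes p q r :: real
  assumes "p > 0" "q > 0" "r > 0"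
  shows "\<exists>P Q R :: real ^ 2. dist Q R = q + r \<and> dist P R = p + r \<and> dist P Q = p + q"
proof -
  \<comment> \<open>Side \<open>P Q\<close> lies on the first axis; \<open>u\<close> comes from the law of cosines, and the height \<open>v\<close>
      is twice Heron's area divided by this side.\<close>
  define u where "u = ((p + r)\<^sup>2 + (p + q)\<^sup>2 - (q + r)\<^sup>2) / (2 * (p + q))"
  define v where "v = 2 * sqrt ((p + q + r) * p * q * r) / (p + q)"
  define P Q R :: "real ^ 2" where "P = vector [0, 0]" and "Q = vector [p + q, 0]"
    and "R = vector [u, v]"
  have pq: "p + q \<noteq> 0" using assms by simp
  have u: "2 * (p + q) * u = (p + r)\<^sup>2 + (p + q)\<^sup>2 - (q + r)\<^sup>2"
    using pq by (simp add: u_def)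
  have "(p + q) * v = 2 * sqrt ((p + q + r) * p * q * r)"
    using pq by (simp add: v_def)
  then have v: "((p + q) * v)\<^sup>2 = 4 * ((p + q + r) * p * q * r)"
    using assms by (simp add: power_mult_distrib)
  have "4 * (p + q)\<^sup>2 * (u\<^sup>2 + v\<^sup>2) = (2 * (p + q) * u)\<^sup>2 + 4 * ((p + q) * v)\<^sup>2"
    by (simp add: power2_eq_square algebra_simps)
  also have "\<dots> = 4 * (p + q)\<^sup>2 * (p + r)\<^sup>2"
    unfolding u v by (simp add: power2_eq_square algebra_simps)
  finally have PR: "u\<^sup>2 + v\<^sup>2 = (p + r)\<^sup>2"
    using pq by simp
  have "(p + q - u)\<^sup>2 + v\<^sup>2 = (p + q)\<^sup>2 - 2 * (p + q) * u + (u\<^sup>2 + v\<^sup>2)"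
    by (simp add: power2_eq_square algebra_simps)
  also have "\<dots> = (q + r)\<^sup>2"
    unfolding u PR by simp
  finally have QR: "(p + q - u)\<^sup>2 + v\<^sup>2 = (q + r)\<^sup>2" .
  have "dist Q R = q + r" "dist P R = p + r" "dist P Q = p + q"
    using assms PR QR
    by (simp_all add: P_def Q_def R_def dist_vec_def L2_set_def dist_real_def sum_2
        real_sqrt_unique)
  then show ?thesis by blast
qed

lemma triangle_area_tangent_lengths:
  fixes p q r S :: real
  assumes pos: "p > 0" "q > 0" "r > 0"
  shows "triangle_area (q + r) (p + r) (p + q) S \<longleftrightarrow> S = sqrt ((p + q + r) * p * q * r)"
proof -
  have area: "measure lebesgue (convex hull {P, Q, R}) = sqrt ((p + q + r) * p * q * r)"
    if d: "dist Q R = q + r" "dist P R = p + r" "dist P Q = p + q" for P Q R :: "real ^ 2"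
  proof -
    have "measure lebesgue (convex hull {P, Q, R}) = measure lborel (convex hull {P, Q, R})"
      by (intro measure_completion)
        (auto intro: borel_closed compact_imp_closed finite_imp_compact_convex_hull)
    also have "\<dots> = sqrt ((p + q + r) * p * q * r)"
    proof -
      have "(q + r + (p + r) + (p + q)) / 2 = p + q + r" by simp
      then show ?thesis by (simp only: heron d) (simp add: algebra_simps)
    qed
    finally show ?thesis .
  qed
  show ?thesis
    unfolding triangle_area_def
    using ex_triangle_with_tangent_lengths[OF pos] not_collinear_if_tangent_lengths[OF pos] area
    by metis
qed

lemma triangle_area_of_quadruple:
  fixes x y z t D S :: real
  assumes "x > 0" "y > 0" "z > 0" "t > 0" "D > 0" and quad: "x\<^sup>2 + y\<^sup>2 + z\<^sup>2 = t\<^sup>2"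
  shows "triangle_area (D * (y\<^sup>2 + z\<^sup>2) / 2) (D * (x\<^sup>2 + z\<^sup>2) / 2) (D * (x\<^sup>2 + y\<^sup>2) / 2) S \<longleftrightarrow>
           S = x * y * z * t * D\<^sup>2 / 4"
proof -
  have "D * x\<^sup>2 / 2 + D * y\<^sup>2 / 2 + D * z\<^sup>2 / 2 = D * t\<^sup>2 / 2"
    unfolding quad[symmetric] by (simp add: field_simps)
  then have "sqrt ((D * x\<^sup>2 / 2 + D * y\<^sup>2 / 2 + D * z\<^sup>2 / 2) * (D * x\<^sup>2 / 2) * (D * y\<^sup>2 / 2) * (D * z\<^sup>2 / 2))
      = sqrt (D * t\<^sup>2 / 2 * (D * x\<^sup>2 / 2) * (D * y\<^sup>2 / 2) * (D * z\<^sup>2 / 2))"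
    by (simp only:)
  also have "\<dots> = sqrt ((x * y * z * t * D\<^sup>2 / 4)\<^sup>2)"
    by (simp add: power2_eq_square)
  also have "\<dots> = x * y * z * t * D\<^sup>2 / 4"
    using assms by simp
  finally have heron_eq: "sqrt ((D * x\<^sup>2 / 2 + D * y\<^sup>2 / 2 + D * z\<^sup>2 / 2)
      * (D * x\<^sup>2 / 2) * (D * y\<^sup>2 / 2) * (D * z\<^sup>2 / 2)) = x * y * z * t * D\<^sup>2 / 4" .
  have sides: "D * (m\<^sup>2 + n\<^sup>2) / 2 = D * m\<^sup>2 / 2 + D * n\<^sup>2 / 2" for m n
    by (simp add: field_simps)
  show ?thesis
    unfolding sides heron_eq[symmetric]
    by (rule triangle_area_tangent_lengths) (use assms in simp_all)
qed

section \<open>Parity and primitive quadruples\<close>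

text \<open>Modulo \<open>4\<close> a sum of three squares counts the odd terms, and a square is neither \<open>2\<close> nor \<open>3\<close>.\<close>

lemma quadruple_parity:
  fixes x y z t :: nat
  assumes "x\<^sup>2 + y\<^sup>2 + z\<^sup>2 = t\<^sup>2"
  shows "exactly_two_even x y z \<or> even x \<and> even y \<and> even z"
proof -
  have sq: "n\<^sup>2 mod 4 = (if even n then 0 else 1)" for n :: nat
  proof (cases "even n")
    case True
    then show ?thesis by (auto elim!: evenE simp: power_mult_distrib)
  next
    case False
    then obtain k where "n = 2 * k + 1" by (elim oddE)
    then have "n\<^sup>2 = 1 + 4 * (k\<^sup>2 + k)"
      by (simp add: power2_eq_square algebra_simps)
    then show ?thesis using False by simp
  qed
  have "t\<^sup>2 mod 4 = ((x\<^sup>2 + y\<^sup>2) mod 4 + z\<^sup>2 mod 4) mod 4"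
    unfolding assms[symmetric] by (rule mod_add_eq[symmetric])
  also have "(x\<^sup>2 + y\<^sup>2) mod 4 = (x\<^sup>2 mod 4 + y\<^sup>2 mod 4) mod 4"
    by (rule mod_add_eq[symmetric])
  finally have "t\<^sup>2 mod 4 = ((x\<^sup>2 mod 4 + y\<^sup>2 mod 4) mod 4 + z\<^sup>2 mod 4) mod 4" .
  then show ?thesis
    unfolding sq exactly_two_even_def by (auto split: if_splits)
qed

lemma primitive_quadruple_parity:
  fixes x y z t :: nat
  assumes "x\<^sup>2 + y\<^sup>2 + z\<^sup>2 = t\<^sup>2" "Gcd {x, y, z} = 1"
  shows "exactly_two_even x y z"
proof (rule ccontr)
  assume "\<not> exactly_two_even x y z"
  with quadruple_parity[OF assms(1)] have "2 dvd Gcd {x, y, z}"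
    by (intro Gcd_greatest) auto
  with assms(2) show False by simp
qed

lemma quadruple_primitive_part:
  fixes x y z t :: nat
  assumes "x > 0" and quad: "x\<^sup>2 + y\<^sup>2 + z\<^sup>2 = t\<^sup>2"
  obtains g x0 y0 z0 t0 where "g > 0" "x = g * x0" "y = g * y0" "z = g * z0" "t = g * t0"
    "x0\<^sup>2 + y0\<^sup>2 + z0\<^sup>2 = t0\<^sup>2" "Gcd {x0, y0, z0} = 1"
proof -
  define g where "g = gcd x (gcd y z)"
  have g: "g > 0" using assms(1) by (simp add: g_def)
  have "g dvd x" "g dvd y" "g dvd z"
    unfolding g_def by (simp_all add: dvd_trans[OF gcd_dvd2])
  then obtain x0 y0 z0 where e: "x = g * x0" "y = g * y0" "z = g * z0"
    by (elim dvdE)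
  have "g\<^sup>2 dvd x\<^sup>2 + y\<^sup>2 + z\<^sup>2"
    by (simp add: e power_mult_distrib)
  then have "g dvd t" unfolding quad by simp
  then obtain t0 where t: "t = g * t0" by (elim dvdE)
  have "g\<^sup>2 * (x0\<^sup>2 + y0\<^sup>2 + z0\<^sup>2) = g\<^sup>2 * t0\<^sup>2"
    using quad by (simp add: e t power_mult_distrib distrib_left)
  then have q0: "x0\<^sup>2 + y0\<^sup>2 + z0\<^sup>2 = t0\<^sup>2" using g by simp
  have "g * gcd x0 (gcd y0 z0) = g"
    by (simp only: gcd_mult_distrib_nat flip: e g_def)
  then have "Gcd {x0, y0, z0} = 1" using g by simp
  with that g e t q0 show thesis by blast
qed

lemma exactly_two_even_odd_mult:
  "odd g \<Longrightarrow> exactly_two_even (g * x) (g * y) (g * z) \<longleftrightarrow> exactly_two_even x y z"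
  by (simp add: exactly_two_even_def)

section \<open>Solid rectangular numbers as areas\<close>

theorem mainTheorem3:
  fixes A :: nat
  assumes "A > 0"
  shows "solid_rectangular A \<longleftrightarrow>
    (\<exists>x y z t D a b c :: nat.
       x > 0 \<and> y > 0 \<and> z > 0 \<and> t > 0 \<and> D > 0 \<and>
       x^2 + y^2 + z^2 = t^2 \<and>
       (exactly_two_even x y z \<longrightarrow> even D) \<and>
       real a = real D * (real y^2 + real z^2) / 2 \<and>
       real b = real D * (real x^2 + real z^2) / 2 \<and>
       real c = real D * (real x^2 + real y^2) / 2 \<and>
       triangle_area (real a) (real b) (real c) (real A))"
    (is "_ \<longleftrightarrow> ?rhs")
proof -
  have area: "triangle_area (real D * (real y^2 + real z^2) / 2) (real D * (real x^2 + real z^2) / 2)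
        (real D * (real x^2 + real y^2) / 2) (real A) \<longleftrightarrow> real A = real (x * y * z * t * D^2) / 4"
    if "x > 0" "y > 0" "z > 0" "t > 0" "D > 0" "x^2 + y^2 + z^2 = t^2" for x y z t D :: nat
  proof -
    have "(real x)\<^sup>2 + (real y)\<^sup>2 + (real z)\<^sup>2 = (real t)\<^sup>2"
      using that(6) by (metis of_nat_add of_nat_power)
    then show ?thesis
      using that by (subst triangle_area_of_quadruple[where t = "real t"]) simp_all
  qed
  show ?thesis
  proof
    assume "solid_rectangular A"
    then obtain x y z t d where q: "x > 0" "y > 0" "z > 0" "t > 0" "d > 0"
      "x^2 + y^2 + z^2 = t^2" and "even d" and A: "real A = real (x * y * z * t * d^2) / 4"
      unfolding solid_rectangular_def by blast
    \<comment> \<open>Evenness of \<open>d\<close> also makes the sides integral.\<close>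
    obtain k where k: "d = 2 * k" using \<open>even d\<close> by (elim evenE)
    have half: "real (k * (m^2 + n^2)) = real d * (real m^2 + real n^2) / 2" for m n :: nat
      by (simp add: k)
    show ?rhs
    proof (intro exI conjI)
      show "real (k * (y^2 + z^2)) = real d * (real y^2 + real z^2) / 2"
        "real (k * (x^2 + z^2)) = real d * (real x^2 + real z^2) / 2"
        "real (k * (x^2 + y^2)) = real d * (real x^2 + real y^2) / 2"
        by (rule half)+
      show "triangle_area (real (k * (y^2 + z^2))) (real (k * (x^2 + z^2)))
          (real (k * (x^2 + y^2))) (real A)"
        unfolding half using area[OF q] A by blast
    qed (use q \<open>even d\<close> in simp_all)
  next
    assume ?rhs
    then obtain x y z t D a b c where q: "x > 0" "y > 0" "z > 0" "t > 0" "D > 0"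
      "x^2 + y^2 + z^2 = t^2" and D: "exactly_two_even x y z \<longrightarrow> even D"
      and a: "real a = real D * (real y^2 + real z^2) / 2"
        "real b = real D * (real x^2 + real z^2) / 2"
        "real c = real D * (real x^2 + real y^2) / 2"
      and "triangle_area (real a) (real b) (real c) (real A)"
      by blast
    then have A: "real A = real (x * y * z * t * D^2) / 4"
      using area[OF q] unfolding a by blast
    obtain g x0 y0 z0 t0 where e: "g > 0" "x = g * x0" "y = g * y0" "z = g * z0" "t = g * t0"
      and prim: "x0\<^sup>2 + y0\<^sup>2 + z0\<^sup>2 = t0\<^sup>2" "Gcd {x0, y0, z0} = 1"
      using quadruple_primitive_part[OF q(1) q(6)] by blast
    have d_even: "even (g^2 * D)"
      using D primitive_quadruple_parity[OF prim] exactly_two_even_odd_mult[of g x0 y0 z0] e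
      by auto
    have "x * y * z * t * D^2 = x0 * y0 * z0 * t0 * (g^2 * D)^2"
      by (simp add: e power2_eq_square algebra_simps)
    with A have "real A = real (x0 * y0 * z0 * t0 * (g^2 * D)^2) / 4"
      by (simp only:)
    moreover have "x0 > 0" "y0 > 0" "z0 > 0" "t0 > 0" "g^2 * D > 0"
      using q e by auto
    ultimately show "solid_rectangular A"
      unfolding solid_rectangular_def using assms prim d_even by blast
  qed
qed

end
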